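(* Let $n\ge 1$. There does not exist any (nonempty) properly immersed self-translating $n$-dimensional hypersurface $\Sigma^n\subseteq\mathbb{R}^{n+1}$, without boundary, which is contained in two transverse vertical halfspaces of $\mathbb{R}^{n+1}$, i.e. such that $\Sigma\subseteq H_1\cap H_2$ for two transverse vertical halfspaces $H_1,H_2$.
   Context: A self-translating hypersurface (self-translater) $\Sigma^n\subseteq\mathbb{R}^{n+1}$ is a smooth immersed hypersurface satisfying $\boldsymbol{H}=\langle e_{n+1},\nu\rangle\,\nu$, where $\boldsymbol{H}$ is the mean curvature vector (the trace of the vector-valued second fundamental form $A(X,Y)=(\nabla^{\mathbb{R}^{n+1}}_XY)^\perp$), $\nu$ is a (local) unit normal, and $e_{n+1}$ is the last standard basis vector; equivalently $\boldsymbol{H}=e_{n+1}^\perp$. Under mean curvature flow it moves by unit speed translation in the direction $e_{n+1}$. "Contained in" refers to the image of the immersion. A (closed, affine) halfspace is $H_{(b,w)}=\{x\in\mathbb{R}^{n+1}:\langle x-b,w\rangle\ge 0\}$ with $b\in\mathbb{R}^{n+1}$ and $w\in\mathbb{S}^n$ a unit vector. It is vertical if $\langle w,e_{n+1}\rangle=0$. Two halfspaces $H_{(b_1,w_1)},H_{(b_2,w_2)}$ are transverse if $w_1$ and $w_2$ are neither parallel nor antiparallel, i.e. $w_1\neq\pm w_2$. *)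

theory Defs
  imports "HOL-Analysis.Analysis"
begin

text \<open>
  The ambient space $R^{n+1}$ is \<open>(real^'n) \<times> real\<close> with \<open>n = CARD('n)\<close>: the library's inner product,
  norm and topology on this product are the Euclidean ones, and the second factor is the last
  coordinate. The condition $n \ge 1$ is automatic because types are nonempty.
\<close>

definition e_last :: "(real^'n) \<times> real"
  where "e_last = (0, 1)"

text \<open>\<open>Ck_on\<close> and \<open>smooth_on\<close> are meant for open sets only: derivatives are taken in the full space.\<close>

fun Ck_on :: "nat \<Rightarrow> 'a::real_normed_vector set \<Rightarrow> ('a \<Rightarrow> 'b::real_normed_vector) \<Rightarrow> bool"
  where
    "Ck_on 0 S f \<longleftrightarrow> continuous_on S f"
  | "Ck_on (Suc k) S f \<longleftrightarrow> (\<forall>x\<in>S. f differentiable (at x)) \<and>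
       (\<forall>v. Ck_on k S (\<lambda>x. frechet_derivative f (at x) v))"

definition smooth_on :: "'a::real_normed_vector set \<Rightarrow> ('a \<Rightarrow> 'b::real_normed_vector) \<Rightarrow> bool"
  where "smooth_on S f \<longleftrightarrow> (\<forall>k. Ck_on k S f)"

text \<open>
  A chart is a pair \<open>(U, \<phi>)\<close>; the values of \<open>\<phi>\<close> outside \<open>U\<close> are irrelevant. Chart images are open in
  the whole of \<open>real^'n\<close>, so these are manifolds without boundary.
\<close>

type_synonym ('m, 'n) chart = "'m set \<times> ('m \<Rightarrow> real^'n)"

definition is_chart :: "'m topology \<Rightarrow> ('m, 'n::finite) chart \<Rightarrow> bool"
  where "is_chart M c \<longleftrightarrow> (case c of (U, \<phi>) \<Rightarrow>
           openin M U \<and> open (\<phi> ` U) \<and>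
           homeomorphic_map (subtopology M U) (top_of_set (\<phi> ` U)) \<phi>)"

definition smooth_manifold :: "'m topology \<Rightarrow> ('m, 'n::finite) chart set \<Rightarrow> bool"
  where "smooth_manifold M \<A> \<longleftrightarrow>
           Hausdorff_space M \<and> second_countable M \<and>
           (\<forall>c\<in>\<A>. is_chart M c) \<and>
           (\<Union>(U, \<phi>)\<in>\<A>. U) = topspace M \<and>
           (\<forall>(U, \<phi>)\<in>\<A>. \<forall>(V, \<psi>)\<in>\<A>. smooth_on (\<phi> ` (U \<inter> V)) (\<psi> \<circ> inv_into U \<phi>))"

definition chart_repr :: "('m, 'n::finite) chart \<Rightarrow> ('m \<Rightarrow> 'b) \<Rightarrow> real^'n \<Rightarrow> 'b"
  where "chart_repr c F = F \<circ> inv_into (fst c) (snd c)"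

definition smooth_immersion ::
    "('m, 'n::finite) chart set \<Rightarrow> ('m \<Rightarrow> (real^'n) \<times> real) \<Rightarrow> bool"
  where "smooth_immersion \<A> F \<longleftrightarrow> (\<forall>c\<in>\<A>.
           smooth_on (snd c ` fst c) (chart_repr c F) \<and>
           (\<forall>x \<in> snd c ` fst c. inj (frechet_derivative (chart_repr c F) (at x))))"

definition properly_immersed_hypersurface ::
    "'m topology \<Rightarrow> ('m, 'n::finite) chart set \<Rightarrow> ('m \<Rightarrow> (real^'n) \<times> real) \<Rightarrow> bool"
  where "properly_immersed_hypersurface M \<A> F \<longleftrightarrow>
           smooth_manifold M \<A> \<and> smooth_immersion \<A> F \<and> proper_map M euclidean F"

text \<open>
  Geometry of a local parametrisation \<open>f\<close> of the hypersurface at the parameter \<open>x\<close>. In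
  \<open>second_fundamental_form\<close> the vector fields $X$, $Y$ are the images under the derivative of \<open>f\<close> of the
  constant fields \<open>u\<close>, \<open>v\<close>, so that the ambient derivative of $Y$ along $X$ is the second derivative
  of \<open>f\<close>. The trace is taken with respect to the induced metric, with the inverse Gram matrix
  playing the role of $g^{ij}$.
\<close>

definition tangent_space :: "(real^'n::finite \<Rightarrow> (real^'n) \<times> real) \<Rightarrow> real^'n \<Rightarrow> ((real^'n) \<times> real) set"
  where "tangent_space f x = range (frechet_derivative f (at x))"

definition normal_part :: "'a::euclidean_space set \<Rightarrow> 'a \<Rightarrow> 'a"
  where "normal_part T v = (THE w. w \<in> orthogonal_comp T \<and> v - w \<in> T)"

definition unit_normal :: "'a::euclidean_space set \<Rightarrow> 'a \<Rightarrow> bool"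
  where "unit_normal T \<nu> \<longleftrightarrow> norm \<nu> = 1 \<and> \<nu> \<in> orthogonal_comp T"

definition second_fundamental_form ::
    "(real^'n::finite \<Rightarrow> (real^'n) \<times> real) \<Rightarrow> real^'n \<Rightarrow> real^'n \<Rightarrow> real^'n \<Rightarrow> (real^'n) \<times> real"
  where "second_fundamental_form f x u v =
           normal_part (tangent_space f x)
             (frechet_derivative (\<lambda>y. frechet_derivative f (at y) v) (at x) u)"

definition metric_matrix :: "(real^'n::finite \<Rightarrow> (real^'n) \<times> real) \<Rightarrow> real^'n \<Rightarrow> real^'n^'n"
  where "metric_matrix f x =
           (\<chi> i j. frechet_derivative f (at x) (axis i 1) \<bullet> frechet_derivative f (at x) (axis j 1))"

definition mean_curvature_vector ::
    "(real^'n::finite \<Rightarrow> (real^'n) \<times> real) \<Rightarrow> real^'n \<Rightarrow> (real^'n) \<times> real"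
  where "mean_curvature_vector f x =
           (\<Sum>i\<in>UNIV. \<Sum>j\<in>UNIV. (matrix_inv (metric_matrix f x) $ i $ j) *\<^sub>R
              second_fundamental_form f x (axis i 1) (axis j 1))"

text \<open>
  The right-hand side of the equation does not change under \<open>\<nu> \<mapsto> - \<nu>\<close>, and the tangent space of an
  immersion has exactly two unit normals, so it does not matter which one is used.
\<close>

definition self_translating ::
    "('m, 'n::finite) chart set \<Rightarrow> ('m \<Rightarrow> (real^'n) \<times> real) \<Rightarrow> bool"
  where "self_translating \<A> F \<longleftrightarrow> (\<forall>c\<in>\<A>. \<forall>x \<in> snd c ` fst c. \<forall>\<nu>.
           unit_normal (tangent_space (chart_repr c F) x) \<nu> \<longrightarrow>
           mean_curvature_vector (chart_repr c F) x = (e_last \<bullet> \<nu>) *\<^sub>R \<nu>)"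

definition halfspace :: "'a::euclidean_space \<Rightarrow> 'a \<Rightarrow> 'a set"
  where "halfspace b w = {x. (x - b) \<bullet> w \<ge> 0}"

end

theory Submission
  imports Defs
begin

text \<open>
  Write \<open>e\<close> for the translation direction. Along a translator, a local maximum of the restriction
  of an ambient function \<open>g\<close> is governed by a second-order inequality that no longer contains the
  curvature: at a critical point the gradient of \<open>g\<close> is normal, so pairing it with the mean
  curvature vector, the normal part of \<open>e\<close>, gives the derivative of \<open>g\<close> in the direction \<open>e\<close>
  itself, and the trace of the second-derivative test becomes

    (trace of the Hessian of \<open>g\<close> over the tangent space) + (derivative of \<open>g\<close> along \<open>e\<close>) \<open>\<le> 0\<close>

  (\<open>translator_max_principle\<close>). The theorem follows by exhibiting a \<open>g\<close> which violates this.

  Let \<open>l1, l2 \<ge> 0\<close> be the affine functions that cut out the two halfspaces and put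
  \<open>Q = (l1 - c)^2 + (l2 - c)^2 - c^2\<close>. The tangent space misses a single direction while the
  Hessian of \<open>Q\<close> is positive definite on the plane spanned by \<open>w1\<close> and \<open>w2\<close>, so its tangential
  trace has the positive lower bound \<open>2 (1 - |w1 \<bullet> w2|)\<close>, whatever the tangent space is
  (\<open>sum_inner_squares_le\<close>); and \<open>Q\<close> is constant along \<open>e\<close> because the halfspaces are vertical. So \<open>Q\<close>
  has no local maximum on a translator, and the inequality leaves room for a small perturbation.

  In the coordinates \<open>l1, l2\<close> the wedge is a quadrant, and the zero set of \<open>Q\<close> is the circle of
  radius \<open>c\<close> that touches both of its sides. It separates the corner from the rest: on the segment
  \<open>l1 + l2 = c\<close> between the two points of contact \<open>Q\<close> is not positive, whereas, for \<open>c\<close> large, a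
  given point of the hypersurface lies on the corner side of the circle, where \<open>Q\<close> is positive.
  Thus the restriction of \<open>Q\<close> to the part of the hypersurface over the bounded triangle
  \<open>l1 + l2 \<le> c\<close> wants to have an interior maximum. Only the triangle is bounded, however, and not
  the set of points over it, so a maximum need not be attained. Instead one maximises
  \<open>Q / (K + |x|^2)\<close>, which tends to \<open>0\<close> at infinity because \<open>Q\<close> is bounded over the triangle;
  the maximum is attained because a proper map has closed image. If \<open>\<delta>\<close> is the maximal value, then
  \<open>Q - \<delta> |x|^2\<close> has a local maximum at the same point, and a large \<open>K\<close> makes the perturbation
  harmless (\<open>closed_set_in_wedge_touching_quadratic\<close>).
\<close>

section \<open>Traces with respect to the induced metric\<close>

lemma matrix_inv_eq_of_right_inverse:
  fixes A B :: "real^'n::finite^'n"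
  assumes "A ** B = mat 1"
  shows "matrix_inv A = B"
proof -
  have BA: "B ** A = mat 1"
    using assms matrix_left_right_inverse by blast
  have "A ** matrix_inv A = mat 1 \<and> matrix_inv A ** A = mat 1"
    unfolding matrix_inv_def by (rule someI[of _ B]) (use assms BA in blast)
  then show ?thesis
    by (metis BA matrix_mul_assoc matrix_mul_lid matrix_mul_rid)
qed

lemma linear_cart_expansion:
  fixes L :: "real^'n::finite \<Rightarrow> 'a::real_vector"
  assumes "linear L"
  shows "L v = (\<Sum>i\<in>UNIV. (v $ i) *\<^sub>R L (axis i 1))"
proof -
  have "L v = L (\<Sum>i\<in>UNIV. (v $ i) *\<^sub>R axis i 1)"
    using basis_expansion[of v] by (simp add: scalar_mult_eq_scaleR)
  then show ?thesis
    by (simp add: linear_sum[OF assms] linear_scale[OF assms])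
qed

text \<open>
  If \<open>V\<close> is the matrix with columns \<open>v k\<close> and \<open>G\<close> the Gram matrix, orthonormality says that
  \<open>V\<^sup>T G V\<close> is the identity; cancelling gives \<open>V V\<^sup>T\<close> as the inverse of \<open>G\<close>.
\<close>

lemma inverse_gram_matrix_orthonormal_frame:
  fixes L :: "real^'n::finite \<Rightarrow> 'a::real_inner" and v :: "'n \<Rightarrow> real^'n"
  assumes L: "linear L" and on: "\<And>k l. L (v k) \<bullet> L (v l) = (if k = l then 1 else 0)"
  shows "matrix_inv (\<chi> i j. L (axis i 1) \<bullet> L (axis j 1)) $ i $ j = (\<Sum>k\<in>UNIV. v k $ i * v k $ j)"
proof -
  define G :: "real^'n^'n" where "G = (\<chi> i j. L (axis i 1) \<bullet> L (axis j 1))"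
  define V :: "real^'n^'n" where "V = (\<chi> i k. v k $ i)"
  have "transpose V ** (G ** V) = mat 1"
  proof -
    have "(transpose V ** (G ** V)) $ k $ l = L (v k) \<bullet> L (v l)" for k l
    proof -
      have "L (v k) \<bullet> L (v l) = (\<Sum>i\<in>UNIV. \<Sum>j\<in>UNIV. v k $ i * (v l $ j * (L (axis i 1) \<bullet> L (axis j 1))))"
      proof -
        have "L (axis i 1) \<bullet> L (v l) = (\<Sum>j\<in>UNIV. v l $ j * (L (axis i 1) \<bullet> L (axis j 1)))" for i
          by (subst linear_cart_expansion[OF L, of "v l"]) (simp add: inner_sum_right)
        then show ?thesis
          by (subst linear_cart_expansion[OF L, of "v k"]) (simp add: inner_sum_left sum_distrib_left)
      qed
      then show ?thesis
        by (simp add: matrix_matrix_mult_def transpose_def G_def V_def sum_distrib_left mult_ac)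
    qed
    then show ?thesis
      by (simp add: vec_eq_iff on mat_def)
  qed
  then have "(G ** V) ** transpose V = mat 1"
    using matrix_left_right_inverse by blast
  then have "matrix_inv G = V ** transpose V"
    by (intro matrix_inv_eq_of_right_inverse) (simp add: matrix_mul_assoc)
  then show ?thesis
    by (simp add: G_def[symmetric]) (simp add: V_def matrix_matrix_mult_def transpose_def)
qed

text \<open>
  This replaces the coordinate contraction with \<open>g\<^sup>i\<^sup>j\<close> in the definition of the mean curvature
  vector by a sum of diagonal values, to which a second-derivative test can be applied term by
  term.
\<close>

lemma trace_bilinear_orthonormal_frame:
  fixes L :: "real^'n::finite \<Rightarrow> 'a::real_inner" and v :: "'n \<Rightarrow> real^'n"
    and B :: "real^'n \<Rightarrow> real^'n \<Rightarrow> real"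
  assumes L: "linear L" and on: "\<And>k l. L (v k) \<bullet> L (v l) = (if k = l then 1 else 0)"
    and B1: "\<And>w. linear (\<lambda>u. B u w)" and B2: "\<And>u. linear (B u)"
  shows "(\<Sum>i\<in>UNIV. \<Sum>j\<in>UNIV.
            matrix_inv (\<chi> i j. L (axis i 1) \<bullet> L (axis j 1)) $ i $ j * B (axis i 1) (axis j 1))
         = (\<Sum>k\<in>UNIV. B (v k) (v k))"
proof -
  have "B (v k) (v k) = (\<Sum>i\<in>UNIV. \<Sum>j\<in>UNIV. v k $ i * v k $ j * B (axis i 1) (axis j 1))" for k
    by (subst linear_cart_expansion[OF B1], subst linear_cart_expansion[OF B2])
       (simp add: sum_distrib_left mult.assoc)
  then have "(\<Sum>k\<in>UNIV. B (v k) (v k))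
      = (\<Sum>k\<in>UNIV. \<Sum>i\<in>UNIV. \<Sum>j\<in>UNIV. v k $ i * v k $ j * B (axis i 1) (axis j 1))"
    by simp
  also have "\<dots> = (\<Sum>i\<in>UNIV. \<Sum>k\<in>UNIV. \<Sum>j\<in>UNIV. v k $ i * v k $ j * B (axis i 1) (axis j 1))"
    by (rule sum.swap)
  also have "\<dots> = (\<Sum>i\<in>UNIV. \<Sum>j\<in>UNIV. \<Sum>k\<in>UNIV. v k $ i * v k $ j * B (axis i 1) (axis j 1))"
    by (intro sum.cong refl sum.swap)
  finally show ?thesis
    by (simp add: inverse_gram_matrix_orthonormal_frame[OF L on] sum_distrib_right)
qed

text \<open>
  An orthonormal basis of the hyperplane \<open>range L\<close> together with a unit normal is an orthonormal
  basis of the whole space; the last conclusion is Parseval's identity for it.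
\<close>

lemma adapted_orthonormal_frame:
  fixes L :: "real^'n::finite \<Rightarrow> 'a::euclidean_space"
  assumes L: "linear L" "inj L" and dim: "DIM('a) = Suc (CARD('n))"
  obtains v :: "'n \<Rightarrow> real^'n" and \<nu> where
    "\<And>k l. L (v k) \<bullet> L (v l) = (if k = l then 1 else 0)"
    "unit_normal (range L) \<nu>"
    "\<And>y z. y \<bullet> z = (\<Sum>k\<in>UNIV. (y \<bullet> L (v k)) * (z \<bullet> L (v k))) + (y \<bullet> \<nu>) * (z \<bullet> \<nu>)"
proof -
  have sub: "subspace (range L)"
    using L(1) linear_subspace_image subspace_UNIV by blast
  have dimT: "dim (range L) = CARD('n)"
    using dim_image_eq[OF L(1), of UNIV] L(2) by (simp add: inj_on_def inj_def)
  obtain B where B: "B \<subseteq> range L" "pairwise orthogonal B" "\<And>x. x \<in> B \<Longrightarrow> norm x = 1"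
      "independent B" "card B = dim (range L)" "span B = range L"
    using orthonormal_basis_subspace[OF sub] by metis
  have finB: "finite B"
    using B(4) independent_imp_finite by blast
  have "card (UNIV :: 'n set) = card B"
    using B(5) dimT by simp
  then obtain t where t: "bij_betw t (UNIV :: 'n set) B"
    using finite_same_card_bij[OF finite_class.finite_UNIV finB] by blast
  define v where "v k = inv L (t k)" for k
  have Lv: "L (v k) = t k" for k
    unfolding v_def using B(1) t by (intro f_inv_into_f) (auto simp: bij_betw_def)
  have tB: "t k \<in> B" for k
    using t by (auto simp: bij_betw_def)
  have on: "L (v k) \<bullet> L (v l) = (if k = l then 1 else 0)" for k l
  proof (cases "k = l")
    case True
    then show ?thesis using B(3)[OF tB[of l]] by (simp add: Lv dot_square_norm)
  next
    case False
    then have "t k \<noteq> t l" using t by (auto simp: bij_betw_def inj_def)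
    then show ?thesis using False B(2) tB by (auto simp: Lv pairwise_def orthogonal_def)
  qed
  obtain z where z: "z \<noteq> 0" "\<And>y. y \<in> span (range L) \<Longrightarrow> orthogonal z y"
    using orthogonal_to_subspace_exists[of "range L"] dim dimT by auto
  define \<nu> where "\<nu> = z /\<^sub>R norm z"
  have n1: "norm \<nu> = 1"
    using z(1) by (simp add: \<nu>_def)
  have orth: "orthogonal \<nu> y" if "y \<in> range L" for y
    using z(2)[OF span_base[OF that]] by (simp add: \<nu>_def orthogonal_def)
  have un: "unit_normal (range L) \<nu>"
    unfolding unit_normal_def orthogonal_comp_def using n1 orth orthogonal_commute by blast
  have notin: "\<nu> \<notin> B"
  proof
    assume "\<nu> \<in> B"
    then have "orthogonal \<nu> \<nu>" using orth B(1) by blast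
    then show False using n1 by (simp add: orthogonal_self)
  qed
  have po: "pairwise orthogonal (insert \<nu> B)"
    using B(1,2) orth by (auto simp: pairwise_insert orthogonal_commute)
  have nz: "0 \<notin> insert \<nu> B"
    using n1 B(3) by force
  have "independent (insert \<nu> B)"
    using pairwise_orthogonal_independent[OF po nz] .
  moreover have "card (insert \<nu> B) = DIM('a)"
    using finB notin B(5) dimT dim by simp
  ultimately have span: "span (insert \<nu> B) = UNIV"
    using card_eq_dim[of "insert \<nu> B" UNIV] finB by auto
  have parseval: "y \<bullet> w = (\<Sum>k\<in>UNIV. (y \<bullet> L (v k)) * (w \<bullet> L (v k))) + (y \<bullet> \<nu>) * (w \<bullet> \<nu>)" for y w
  proof -
    have "y = (\<Sum>b\<in>insert \<nu> B. (y \<bullet> b) *\<^sub>R b)"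
      using orthonormal_basis_expand[OF po, of y] n1 B(3) span finB by (metis UNIV_I finite_insert insert_iff)
    then have "y \<bullet> w = (\<Sum>b\<in>insert \<nu> B. (y \<bullet> b) *\<^sub>R b) \<bullet> w"
      by simp
    also have "\<dots> = (\<Sum>b\<in>B. (y \<bullet> b) * (w \<bullet> b)) + (y \<bullet> \<nu>) * (w \<bullet> \<nu>)"
      using finB notin by (simp add: inner_sum_left inner_sum_right inner_commute[of _ w] inner_add_right)
    also have "(\<Sum>b\<in>B. (y \<bullet> b) * (w \<bullet> b)) = (\<Sum>k\<in>UNIV. (y \<bullet> L (v k)) * (w \<bullet> L (v k)))"
      using sum.reindex_bij_betw[OF t, of "\<lambda>b. (y \<bullet> b) * (w \<bullet> b)"] by (simp add: Lv)
    finally show ?thesis .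
  qed
  show thesis
    using that[OF on un parseval] .
qed

section \<open>A maximum principle for translators\<close>

text \<open>
  The orthogonal projection is only ever paired with normal vectors, and there it is invisible.
\<close>

lemma inner_normal_part:
  fixes T :: "'a::euclidean_space set"
  assumes T: "subspace T" and z: "z \<in> orthogonal_comp T"
  shows "z \<bullet> normal_part T v = z \<bullet> v"
proof -
  obtain a b where ab: "a \<in> span T" "\<And>w. w \<in> span T \<Longrightarrow> orthogonal b w" "v = a + b"
    using orthogonal_subspace_decomp_exists[of T v] by metis
  have sT: "span T = T" using T by simp
  have b: "b \<in> orthogonal_comp T \<and> v - b \<in> T"
    using ab sT by (auto simp: orthogonal_comp_def orthogonal_commute)
  have "normal_part T v = b"
    unfolding normal_part_def
  proof (rule the_equality, rule b)
    fix w assume w: "w \<in> orthogonal_comp T \<and> v - w \<in> T"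
    have "w - b \<in> orthogonal_comp T"
      using w b subspace_orthogonal_comp subspace_diff by blast
    moreover have "(v - b) - (v - w) \<in> T"
      using w b T subspace_diff by blast
    ultimately have "orthogonal (w - b) (w - b)"
      by (auto simp: orthogonal_comp_def)
    then show "w = b" by (simp add: orthogonal_self)
  qed
  moreover have "z \<bullet> a = 0"
    using z ab(1) sT by (auto simp: orthogonal_comp_def orthogonal_def inner_commute)
  ultimately show ?thesis
    by (simp add: ab(3) inner_add_right)
qed

text \<open>
  If \<open>c\<close> were positive, \<open>G'\<close> would be positive just to the right of its zero at \<open>0\<close>, so \<open>G\<close>
  would increase there.
\<close>

lemma second_derivative_nonpos_at_local_max:
  fixes G G' :: "real \<Rightarrow> real"
  assumes d: "d > 0" and G: "\<And>t. \<bar>t\<bar> < d \<Longrightarrow> (G has_real_derivative G' t) (at t)"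
    and G': "(G' has_real_derivative c) (at 0)"
    and max: "\<And>t. \<bar>t\<bar> < d \<Longrightarrow> G t \<le> G 0"
  shows "G' 0 = 0" and "c \<le> 0"
proof -
  show 0: "G' 0 = 0"
    using DERIV_local_max[OF G[of 0] d] max d by simp
  show "c \<le> 0"
  proof (rule ccontr)
    assume "\<not> c \<le> 0"
    then obtain e where e: "e > 0" "\<And>h. 0 < h \<Longrightarrow> h < e \<Longrightarrow> G' 0 < G' (0 + h)"
      using DERIV_pos_inc_right[OF G'] by (meson not_le)
    define r where "r = min d e / 2"
    have r: "0 < r" "r < d" "r < e"
      using d e(1) by (auto simp: r_def min_def)
    obtain s where s: "0 < s" "s < r" "G r - G 0 = (r - 0) * G' s"
      using MVT2[OF r(1), of G G'] G r by (auto simp: abs_if)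
    then have "G r - G 0 > 0"
      using e(2)[of s] 0 r by simp
    then show False using max[of r] r by simp
  qed
qed

text \<open>
  The first and second derivative tests for \<open>g \<circ> f\<close> along the line through \<open>x\<close> in direction \<open>v\<close>.
  The second derivative of \<open>g \<circ> f\<close> splits into the Hessian of \<open>g\<close> on the image of \<open>v\<close> and the
  gradient of \<open>g\<close> against the acceleration, which carries the curvature.
\<close>

lemma max_along_parametrisation:
  fixes f :: "'a::real_normed_vector \<Rightarrow> 'b::real_inner"
  assumes S: "open S" "x \<in> S" and f: "\<And>y. y \<in> S \<Longrightarrow> f differentiable (at y)"
    and f2: "(\<lambda>y. frechet_derivative f (at y) v) differentiable (at x)"
    and g: "\<And>y. (g has_derivative (\<lambda>h. grad y \<bullet> h)) (at y)"
    and gr: "(grad has_derivative Hs) (at (f x))"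
    and max: "\<And>y. y \<in> S \<Longrightarrow> g (f y) \<le> g (f x)"
  shows "grad (f x) \<bullet> frechet_derivative f (at x) v = 0"
    and "Hs (frechet_derivative f (at x) v) \<bullet> frechet_derivative f (at x) v
         + grad (f x) \<bullet> frechet_derivative (\<lambda>y. frechet_derivative f (at y) v) (at x) v \<le> 0"
proof -
  define D where "D = (\<lambda>y. frechet_derivative f (at y) v)"
  obtain e where e: "e > 0" "ball x e \<subseteq> S"
    using S open_contains_ball by blast
  define d where "d = e / (norm v + 1)"
  have nv: "norm v + 1 > 0" by (simp add: add_nonneg_pos)
  have d: "d > 0" using e nv by (simp add: d_def)
  have inS: "x + t *\<^sub>R v \<in> S" if "\<bar>t\<bar> < d" for t
  proof -
    have "\<bar>t\<bar> * norm v \<le> \<bar>t\<bar> * (norm v + 1)" by (simp add: mult_left_mono)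
    also have "\<dots> < e" using that nv by (simp add: d_def field_simps)
    finally show ?thesis using e by (auto simp: dist_norm)
  qed
  have line: "((\<lambda>t. x + t *\<^sub>R v) has_derivative (\<lambda>s. s *\<^sub>R v)) (at t)" for t
    by (auto intro!: derivative_eq_intros)
  have df: "((\<lambda>t. f (x + t *\<^sub>R v)) has_derivative (\<lambda>s. s *\<^sub>R D (x + t *\<^sub>R v))) (at t)" if "\<bar>t\<bar> < d" for t
  proof -
    have "(f has_derivative frechet_derivative f (at (x + t *\<^sub>R v))) (at (x + t *\<^sub>R v))"
      using f[OF inS[OF that]] frechet_derivative_works by blast
    from has_derivative_compose[OF line this] show ?thesis
      by (simp add: D_def linear_scale[OF linear_frechet_derivative[OF f[OF inS[OF that]]]])
  qed
  define D2 where "D2 = frechet_derivative D (at x) v"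
  have dD: "((\<lambda>t. D (x + t *\<^sub>R v)) has_derivative (\<lambda>s. s *\<^sub>R D2)) (at 0)"
  proof -
    have "(D has_derivative frechet_derivative D (at x)) (at (x + 0 *\<^sub>R v))"
      using f2 frechet_derivative_works by (auto simp: D_def)
    from has_derivative_compose[OF line this] show ?thesis
      using linear_scale[OF linear_frechet_derivative[OF f2]] by (simp add: D_def D2_def)
  qed
  define G where "G = (\<lambda>t. g (f (x + t *\<^sub>R v)))"
  define G' where "G' = (\<lambda>t. grad (f (x + t *\<^sub>R v)) \<bullet> D (x + t *\<^sub>R v))"
  have G: "(G has_real_derivative G' t) (at t)" if "\<bar>t\<bar> < d" for t
    using has_derivative_compose[OF df[OF that] g]
    unfolding G_def G'_def has_field_derivative_def
    by (rule has_derivative_eq_rhs) (simp add: fun_eq_iff)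
  have gr': "((\<lambda>t. grad (f (x + t *\<^sub>R v))) has_derivative (\<lambda>s. s *\<^sub>R Hs (D x))) (at 0)"
  proof -
    have "(grad has_derivative Hs) (at (f (x + 0 *\<^sub>R v)))" using gr by simp
    from has_derivative_compose[OF df[of 0] this] d show ?thesis
      by (simp add: linear_scale[OF has_derivative_linear[OF gr]])
  qed
  have G': "(G' has_real_derivative (Hs (D x) \<bullet> D x + grad (f x) \<bullet> D2)) (at 0)"
    unfolding G'_def has_field_derivative_def
    by (rule has_derivative_eq_rhs[OF has_derivative_inner[OF gr' dD]])
       (simp add: fun_eq_iff algebra_simps)
  have "G' 0 = 0" "Hs (D x) \<bullet> D x + grad (f x) \<bullet> D2 \<le> 0"
    using second_derivative_nonpos_at_local_max[OF d G G'] max inS by (simp_all add: G_def)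
  then show "grad (f x) \<bullet> frechet_derivative f (at x) v = 0"
    "Hs (frechet_derivative f (at x) v) \<bullet> frechet_derivative f (at x) v
         + grad (f x) \<bullet> frechet_derivative (\<lambda>y. frechet_derivative f (at y) v) (at x) v \<le> 0"
    by (simp_all add: G'_def D_def D2_def)
qed

lemma smooth_on_differentiable:
  assumes "smooth_on S f" "x \<in> S"
  shows "f differentiable (at x)"
    and "(\<lambda>y. frechet_derivative f (at y) v) differentiable (at x)"
proof -
  have "Ck_on (Suc (Suc 0)) S f" using assms(1) unfolding smooth_on_def by blast
  then show "f differentiable (at x)" "(\<lambda>y. frechet_derivative f (at y) v) differentiable (at x)"
    using assms(2) by simp_all
qed

text \<open>
  Linearity in \<open>v\<close> needs openness of \<open>S\<close>: only near \<open>x\<close>, where \<open>f\<close> is differentiable, does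
  the derivative of \<open>f\<close> depend linearly on the direction.
\<close>

lemma linear_second_derivative:
  assumes S: "open S" "x \<in> S" and f: "smooth_on S f"
  shows "linear (\<lambda>u. frechet_derivative (\<lambda>y. frechet_derivative f (at y) v) (at x) u)"
    and "linear (\<lambda>v. frechet_derivative (\<lambda>y. frechet_derivative f (at y) v) (at x) u)"
proof -
  note diff = smooth_on_differentiable[OF f]
  show "linear (\<lambda>u. frechet_derivative (\<lambda>y. frechet_derivative f (at y) v) (at x) u)"
    using linear_frechet_derivative[OF diff(2)[OF S(2)]] by simp
  note D = diff(2)[OF S(2), unfolded frechet_derivative_works]
  show "linear (\<lambda>v. frechet_derivative (\<lambda>y. frechet_derivative f (at y) v) (at x) u)"
  proof (rule linearI)
    fix v w
    have "((\<lambda>y. frechet_derivative f (at y) (v + w)) has_derivative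
        (\<lambda>u. frechet_derivative (\<lambda>y. frechet_derivative f (at y) v) (at x) u
            + frechet_derivative (\<lambda>y. frechet_derivative f (at y) w) (at x) u)) (at x)"
      by (rule has_derivative_transform_within_open[OF has_derivative_add[OF D D] S])
         (simp add: linear_add[OF linear_frechet_derivative[OF diff(1)]])
    from fun_cong[OF frechet_derivative_at[OF this], of u, THEN sym]
    show "frechet_derivative (\<lambda>y. frechet_derivative f (at y) (v + w)) (at x) u =
        frechet_derivative (\<lambda>y. frechet_derivative f (at y) v) (at x) u
            + frechet_derivative (\<lambda>y. frechet_derivative f (at y) w) (at x) u"
      by simp
  next
    fix r v
    have "((\<lambda>y. frechet_derivative f (at y) (r *\<^sub>R v)) has_derivative
        (\<lambda>u. r *\<^sub>R frechet_derivative (\<lambda>y. frechet_derivative f (at y) v) (at x) u)) (at x)"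
      by (rule has_derivative_transform_within_open[OF has_derivative_scaleR_right[OF D] S])
         (simp add: linear_scale[OF linear_frechet_derivative[OF diff(1)]])
    from fun_cong[OF frechet_derivative_at[OF this], of u, THEN sym]
    show "frechet_derivative (\<lambda>y. frechet_derivative f (at y) (r *\<^sub>R v)) (at x) u =
        r *\<^sub>R frechet_derivative (\<lambda>y. frechet_derivative f (at y) v) (at x) u"
      by simp
  qed
qed


text \<open>
  Summing the second-derivative test over an orthonormal tangent frame \<open>t\<close> turns the acceleration
  terms into \<open>grad (f x) \<bullet> H\<close>. Since \<open>grad (f x)\<close> is a multiple of the unit normal and \<open>H\<close> is the
  normal part of \<open>e_last\<close>, this equals \<open>grad (f x) \<bullet> e_last\<close>. Thus \<open>f\<close> enters the final inequality
  only through its tangent space. Parseval's identity for \<open>t\<close> and \<open>\<nu>\<close> is kept in the conclusion in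
  order to evaluate the trace of the Hessian.
\<close>

lemma translator_max_principle:
  fixes f :: "real^'n::finite \<Rightarrow> (real^'n) \<times> real"
  assumes S: "open S" and f: "smooth_on S f"
    and W: "open W" "W \<subseteq> S" "x \<in> W"
    and imm: "inj (frechet_derivative f (at x))"
    and trans: "\<And>\<nu>. unit_normal (tangent_space f x) \<nu> \<Longrightarrow> mean_curvature_vector f x = (e_last \<bullet> \<nu>) *\<^sub>R \<nu>"
    and g: "\<And>y. (g has_derivative (\<lambda>h. grad y \<bullet> h)) (at y)"
    and gr: "(grad has_derivative Hs) (at (f x))"
    and max: "\<And>y. y \<in> W \<Longrightarrow> g (f y) \<le> g (f x)"
  obtains t :: "'n \<Rightarrow> (real^'n) \<times> real" and \<nu> where
    "norm \<nu> = 1" "\<And>k. norm (t k) = 1"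
    "\<And>y z. y \<bullet> z = (\<Sum>k\<in>UNIV. (y \<bullet> t k) * (z \<bullet> t k)) + (y \<bullet> \<nu>) * (z \<bullet> \<nu>)"
    "(\<Sum>k\<in>UNIV. Hs (t k) \<bullet> t k) + grad (f x) \<bullet> e_last \<le> 0"
proof -
  define L where "L = frechet_derivative f (at x)"
  define D2 where "D2 u v = frechet_derivative (\<lambda>y. frechet_derivative f (at y) v) (at x) u" for u v
  define z where "z = grad (f x)"
  have xS: "x \<in> S" using W by blast
  note diff = smooth_on_differentiable[OF f]
  have L: "linear L" "inj L"
    using linear_frechet_derivative[OF diff(1)[OF xS]] imm by (simp_all add: L_def)
  have T: "tangent_space f x = range L"
    by (simp add: tangent_space_def L_def)
  have dim: "DIM((real^'n) \<times> real) = Suc (CARD('n))" by simp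
  obtain v :: "'n \<Rightarrow> real^'n" and \<nu> where on: "\<And>k l. L (v k) \<bullet> L (v l) = (if k = l then 1 else 0)"
      and \<nu>: "unit_normal (range L) \<nu>"
      and pars: "\<And>y z. y \<bullet> z = (\<Sum>k\<in>UNIV. (y \<bullet> L (v k)) * (z \<bullet> L (v k))) + (y \<bullet> \<nu>) * (z \<bullet> \<nu>)"
  proof (rule adapted_orthonormal_frame[OF L dim])
    fix v :: "'n \<Rightarrow> real^'n" and \<nu>
    assume "\<And>k l. L (v k) \<bullet> L (v l) = (if k = l then 1 else 0)" "unit_normal (range L) \<nu>"
      "\<And>y z. y \<bullet> z = (\<Sum>k\<in>UNIV. (y \<bullet> L (v k)) * (z \<bullet> L (v k))) + (y \<bullet> \<nu>) * (z \<bullet> \<nu>)"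
    then show thesis by (rule that)
  qed
  note second_order = max_along_parametrisation[OF W(1,3) diff(1)[OF subsetD[OF W(2)]] diff(2)[OF xS] g gr max]
  have crit: "z \<bullet> L u = 0" for u
    unfolding z_def L_def by (rule second_order(1))
  have sec: "Hs (L u) \<bullet> L u + z \<bullet> D2 u u \<le> 0" for u
    unfolding z_def L_def D2_def by (rule second_order(2))
  have zT: "z \<in> orthogonal_comp (range L)"
    using crit by (auto simp: orthogonal_comp_def orthogonal_def inner_commute)
  have sub: "subspace (range L)"
    using L(1) linear_subspace_image subspace_UNIV by blast
  have lin: "linear (\<lambda>u. z \<bullet> D2 u w)" "linear (\<lambda>u. z \<bullet> D2 w u)" for w
    using linear_compose[OF linear_second_derivative(1)[OF S xS f, of w], of "\<lambda>y. z \<bullet> y"]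
      linear_compose[OF linear_second_derivative(2)[OF S xS f, of w], of "\<lambda>y. z \<bullet> y"]
    by (simp_all add: D2_def o_def bounded_linear.linear bounded_linear_inner_right)
  have "z \<bullet> mean_curvature_vector f x = (\<Sum>i\<in>UNIV. \<Sum>j\<in>UNIV.
      matrix_inv (\<chi> i j. L (axis i 1) \<bullet> L (axis j 1)) $ i $ j * (z \<bullet> D2 (axis i 1) (axis j 1)))"
    unfolding mean_curvature_vector_def metric_matrix_def second_fundamental_form_def T
    by (simp add: inner_sum_right inner_normal_part[OF sub zT] flip: L_def D2_def)
  also have "\<dots> = (\<Sum>k\<in>UNIV. z \<bullet> D2 (v k) (v k))"
    by (rule trace_bilinear_orthonormal_frame[OF L(1) on lin])
  finally have H: "z \<bullet> mean_curvature_vector f x = (\<Sum>k\<in>UNIV. z \<bullet> D2 (v k) (v k))" .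
  have "z \<bullet> mean_curvature_vector f x = z \<bullet> e_last"
    using trans[of \<nu>] \<nu> pars[of z e_last] by (simp add: T crit mult.commute)
  moreover have "(\<Sum>k\<in>UNIV. Hs (L (v k)) \<bullet> L (v k)) + (\<Sum>k\<in>UNIV. z \<bullet> D2 (v k) (v k)) \<le> 0"
    unfolding sum.distrib[symmetric] by (rule sum_nonpos) (rule sec)
  ultimately have main: "(\<Sum>k\<in>UNIV. Hs (L (v k)) \<bullet> L (v k)) + grad (f x) \<bullet> e_last \<le> 0"
    using H by (simp add: z_def)
  show thesis
  proof (rule that[of \<nu> "\<lambda>k. L (v k)"])
    show "norm \<nu> = 1" using \<nu> by (simp add: unit_normal_def)
    show "norm (L (v k)) = 1" for k using on[of k k] by (simp add: norm_eq_1)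
  qed (fact pars main)+
qed

section \<open>Closed sets in a wedge\<close>

text \<open>
  The left-hand side is the quadratic form of \<open>w1 w1\<^sup>T + w2 w2\<^sup>T\<close>, whose largest eigenvalue is
  \<open>1 + |w1 \<bullet> w2|\<close>. In the proof the left-hand side \<open>s\<close> is itself an inner product
  \<open>z \<bullet> \<nu>\<close>, and Cauchy-Schwarz bounds \<open>s\<^sup>2\<close> by a multiple of \<open>s\<close>.
\<close>

lemma sum_inner_squares_le:
  fixes w1 w2 \<nu> :: "'a::real_inner"
  assumes "norm w1 = 1" "norm w2 = 1" "norm \<nu> = 1"
  shows "(w1 \<bullet> \<nu>)\<^sup>2 + (w2 \<bullet> \<nu>)\<^sup>2 \<le> 1 + \<bar>w1 \<bullet> w2\<bar>"
proof -
  define p q where "p = w1 \<bullet> \<nu>" and "q = w2 \<bullet> \<nu>"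
  define s where "s = p\<^sup>2 + q\<^sup>2"
  define z where "z = p *\<^sub>R w1 + q *\<^sub>R w2"
  have s0: "s \<ge> 0" by (simp add: s_def)
  have "s = z \<bullet> \<nu>"
    by (simp add: s_def z_def p_def q_def inner_add_left power2_eq_square)
  then have "s \<le> norm z"
    using norm_cauchy_schwarz[of z \<nu>] assms(3) by simp
  then have "s\<^sup>2 \<le> z \<bullet> z"
    using power_mono[of s "norm z" 2] s0 by (simp add: dot_square_norm)
  also have "z \<bullet> z = s + 2 * p * q * (w1 \<bullet> w2)"
    using assms by (simp add: z_def s_def inner_add_left inner_add_right norm_eq_1 inner_commute
        power2_eq_square algebra_simps)
  also have "2 * p * q * (w1 \<bullet> w2) \<le> s * \<bar>w1 \<bullet> w2\<bar>"
  proof -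
    have "\<bar>2 * p * q\<bar> \<le> s"
      using sum_squares_bound[of p q] sum_squares_bound[of "-p" q] by (auto simp: s_def abs_if)
    then have "\<bar>2 * p * q\<bar> * \<bar>w1 \<bullet> w2\<bar> \<le> s * \<bar>w1 \<bullet> w2\<bar>"
      by (simp add: mult_right_mono)
    then show ?thesis
      by (metis abs_ge_self abs_mult order_trans)
  qed
  finally have "s * s \<le> s * (1 + \<bar>w1 \<bullet> w2\<bar>)"
    by (simp add: power2_eq_square algebra_simps)
  then have "s \<le> 1 + \<bar>w1 \<bullet> w2\<bar>"
    using s0 by (cases "s = 0") (auto simp: mult_le_cancel_left)
  then show ?thesis by (simp add: s_def p_def q_def)
qed

lemma abs_inner_lt_1:
  fixes w1 w2 :: "'a::real_inner"
  assumes "norm w1 = 1" "norm w2 = 1" "w1 \<noteq> w2" "w1 \<noteq> - w2"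
  shows "\<bar>w1 \<bullet> w2\<bar> < 1"
proof -
  have "(w1 - w2) \<bullet> (w1 - w2) > 0" "(w1 + w2) \<bullet> (w1 + w2) > 0"
    using assms(3,4) by (auto simp: eq_neg_iff_add_eq_0)
  then show ?thesis
    using assms(1,2) by (simp add: inner_diff inner_add norm_eq_1 inner_commute algebra_simps abs_less_iff)
qed

text \<open>
  The maximisation of \<open>Q / (K + |x|\<^sup>2)\<close> described at the beginning. The parameter \<open>\<delta>\<close> is the
  maximal value; since the numerator is at most \<open>c\<^sup>2\<close> on the region considered,
  \<open>\<delta> * (N + norm y)\<close> is at most \<open>c\<^sup>2 * (N + norm y) / (K + (norm y)\<^sup>2)\<close>, and \<open>K\<close> can be chosen,
  depending on \<open>c\<close>, to make this smaller than any prescribed \<open>\<eta>\<close>, wherever the point \<open>y\<close> may be.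
\<close>

lemma closed_set_in_wedge_touching_quadratic:
  fixes S :: "'a::euclidean_space set"
  assumes S: "closed S" "S \<noteq> {}" and wedge: "S \<subseteq> halfspace b1 w1 \<inter> halfspace b2 w2"
    and \<eta>: "\<eta> > 0" and N: "N \<ge> 0"
  obtains c \<delta> y U where "y \<in> S" "\<delta> \<ge> 0" "\<delta> * (N + norm y) < \<eta>" "open U" "y \<in> U"
    "\<And>x. x \<in> S \<Longrightarrow> x \<in> U \<Longrightarrow>
       ((x - b1) \<bullet> w1 - c)\<^sup>2 + ((x - b2) \<bullet> w2 - c)\<^sup>2 - \<delta> * (x \<bullet> x)
       \<le> ((y - b1) \<bullet> w1 - c)\<^sup>2 + ((y - b2) \<bullet> w2 - c)\<^sup>2 - \<delta> * (y \<bullet> y)"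
proof -
  define l1 l2 where "l1 x = (x - b1) \<bullet> w1" and "l2 x = (x - b2) \<bullet> w2" for x
  have l0: "l1 x \<ge> 0" "l2 x \<ge> 0" if "x \<in> S" for x
    using wedge that by (auto simp: halfspace_def l1_def l2_def)
  obtain p where p: "p \<in> S" using S by blast
  \<comment> \<open>Any \<open>c > 2 (l1 p + l2 p)\<close> puts \<open>p\<close> between the corner and the circle \<open>Q = 0\<close>.\<close>
  define c where "c = 2 * (l1 p + l2 p) + 1"
  have c: "c > 0" using l0[OF p] by (simp add: c_def)
  define Q where "Q x = (l1 x - c)\<^sup>2 + (l2 x - c)\<^sup>2 - c\<^sup>2" for x
  have Q: "Q x = (l1 x + l2 x)\<^sup>2 - 2 * (l1 x * l2 x) - 2 * c * (l1 x + l2 x) + c\<^sup>2" for x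
    by (simp add: Q_def power2_eq_square algebra_simps)
  have Qp: "Q p > 0"
  proof -
    have "Q p = (l1 p)\<^sup>2 + (l2 p)\<^sup>2 + c * (c - 2 * (l1 p + l2 p))"
      by (simp add: Q_def power2_eq_square algebra_simps)
    also have "\<dots> = (l1 p)\<^sup>2 + (l2 p)\<^sup>2 + c" by (simp add: c_def)
    finally show ?thesis using c by (simp add: add_nonneg_pos)
  qed
  have Qface: "Q x \<le> 0" if "x \<in> S" "l1 x + l2 x = c" for x
    using l0[OF that(1)] by (simp add: Q that(2) power2_eq_square)
  have Qbd: "Q x \<le> c\<^sup>2" if "x \<in> S" "l1 x + l2 x \<le> c" for x
  proof -
    have "(l1 x + l2 x) * (l1 x + l2 x) \<le> c * (l1 x + l2 x)"
      using l0[OF that(1)] that(2) by (intro mult_right_mono) auto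
    moreover have "0 \<le> c * (l1 x + l2 x)" "0 \<le> l1 x * l2 x"
      using l0[OF that(1)] c by auto
    ultimately show ?thesis unfolding Q power2_eq_square by linarith
  qed
  \<comment> \<open>\<open>K\<close> must satisfy \<open>a N + a r < K + r\<^sup>2\<close> for all \<open>r\<close>; the worst case is \<open>r = a / 2\<close>.\<close>
  define a where "a = c\<^sup>2 / \<eta>"
  have a: "a > 0" "c\<^sup>2 = a * \<eta>" using c \<eta> by (simp_all add: a_def)
  define K where "K = a * N + a\<^sup>2 + 1"
  have K: "a * (N + r) < K + r\<^sup>2" for r
  proof -
    have "0 \<le> (r - a / 2)\<^sup>2" by simp
    then have "a * r \<le> r\<^sup>2 + a\<^sup>2 / 4" by (simp add: power2_eq_square algebra_simps)
    moreover have "a\<^sup>2 / 4 \<le> a\<^sup>2" by simp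
    ultimately show ?thesis unfolding K_def distrib_left by linarith
  qed
  have K0: "K > 0" using a(1) N by (simp add: K_def add_nonneg_pos)
  define R where "R x = Q x / (K + x \<bullet> x)" for x
  have den: "K + x \<bullet> x > 0" for x using K0 by (simp add: add_pos_nonneg)
  define m0 where "m0 = R p"
  have m0: "m0 > 0" using Qp den[of p] by (simp add: m0_def R_def)
  \<comment> \<open>Points of \<open>S\<close> in the triangle with \<open>R < m0\<close> do not compete with \<open>p\<close>; discarding them leaves a
    compact set.\<close>
  define C where "C = S \<inter> {x. l1 x + l2 x \<le> c} \<inter> {x. R x \<ge> m0}"
  have contl: "continuous_on UNIV l1" "continuous_on UNIV l2"
    unfolding l1_def l2_def by (intro continuous_intros)+
  have contR: "continuous_on UNIV R"
    unfolding R_def Q_def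
    by (intro continuous_intros contl) (metis den less_irrefl)
  have pC: "p \<in> C"
    using p l0[OF p] by (simp add: C_def m0_def c_def)
  have closedC: "closed C"
    unfolding C_def using S(1) contl contR
    by (intro closed_Int closed_Collect_le continuous_intros) auto
  have "bounded C"
  proof (rule boundedI)
    fix x assume x: "x \<in> C"
    then have "m0 * (K + x \<bullet> x) \<le> Q x" using den[of x] by (simp add: C_def R_def pos_le_divide_eq)
    also have "\<dots> \<le> c\<^sup>2" using x Qbd by (simp add: C_def)
    finally have "K + x \<bullet> x \<le> c\<^sup>2 / m0" using m0 by (simp add: pos_le_divide_eq mult.commute)
    then have "(norm x)\<^sup>2 \<le> c\<^sup>2 / m0" using K0 by (simp add: dot_square_norm)
    then show "norm x \<le> sqrt (c\<^sup>2 / m0)" by (rule real_le_rsqrt)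
  qed
  then obtain y where y: "y \<in> C" and ymax: "\<And>x. x \<in> C \<Longrightarrow> R x \<le> R y"
    using continuous_attains_sup[of C R] closedC pC contR
    by (metis compact_eq_bounded_closed continuous_on_subset empty_iff subset_UNIV)
  have yS: "y \<in> S" and yc: "l1 y + l2 y \<le> c" and yR: "R y \<ge> m0"
    using y by (auto simp: C_def)
  define \<delta> where "\<delta> = R y"
  have \<delta>: "\<delta> > 0" using yR m0 by (simp add: \<delta>_def)
  have Qy: "Q y = \<delta> * (K + y \<bullet> y)" using den[of y] by (simp add: \<delta>_def R_def)
  then have "Q y > 0" using \<delta> den[of y] by simp
  \<comment> \<open>\<open>Q y > 0\<close> keeps \<open>y\<close> off the face \<open>l1 + l2 = c\<close>, so that the maximum is a local one on \<open>S\<close>.\<close>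
  then have ylt: "l1 y + l2 y < c" using Qface[OF yS] yc by (metis less_eq_real_def not_le)
  define U where "U = {x. l1 x + l2 x < c}"
  have openU: "open U"
    unfolding U_def using contl by (intro open_Collect_less continuous_intros)
  have small: "\<delta> * (N + norm y) < \<eta>"
  proof -
    have "\<delta> * (a * (N + norm y)) < \<delta> * (K + y \<bullet> y)"
      using K[of "norm y"] \<delta> by (simp add: dot_square_norm)
    also have "\<dots> \<le> a * \<eta>" using Qbd[OF yS yc] Qy a(2) by simp
    finally show ?thesis using a(1) by (simp add: mult.left_commute[of \<delta>])
  qed
  have max: "Q x - \<delta> * (x \<bullet> x) \<le> Q y - \<delta> * (y \<bullet> y)" if x: "x \<in> S" "x \<in> U" for x
  proof -
    have "R x \<le> \<delta>"
      using ymax[of x] x yR by (cases "R x \<ge> m0") (auto simp: C_def U_def \<delta>_def)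
    then have "Q x \<le> \<delta> * (K + x \<bullet> x)"
      using den[of x] by (simp add: R_def pos_divide_le_eq)
    then show ?thesis by (simp add: Qy algebra_simps)
  qed
  show thesis
  proof (rule that[OF yS less_imp_le[OF \<delta>] small openU, of c])
    show "y \<in> U" using ylt by (simp add: U_def)
  next
    fix x assume "x \<in> S" "x \<in> U"
    from max[OF this]
    show "((x - b1) \<bullet> w1 - c)\<^sup>2 + ((x - b2) \<bullet> w2 - c)\<^sup>2 - \<delta> * (x \<bullet> x)
        \<le> ((y - b1) \<bullet> w1 - c)\<^sup>2 + ((y - b2) \<bullet> w2 - c)\<^sup>2 - \<delta> * (y \<bullet> y)"
      unfolding Q_def l1_def l2_def by linarith
  qed
qed

section \<open>Translators in two transverse vertical halfspaces\<close>

lemma wedge_quadratic_derivatives: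
  fixes b1 b2 w1 w2 y :: "'a::real_inner" and c \<delta> :: real
  shows "((\<lambda>x. ((x - b1) \<bullet> w1 - c)\<^sup>2 + ((x - b2) \<bullet> w2 - c)\<^sup>2 - \<delta> * (x \<bullet> x)) has_derivative
      (\<lambda>h. ((2 * ((y - b1) \<bullet> w1 - c)) *\<^sub>R w1 + (2 * ((y - b2) \<bullet> w2 - c)) *\<^sub>R w2 - (2 * \<delta>) *\<^sub>R y) \<bullet> h)) (at y)"
    and "((\<lambda>x. (2 * ((x - b1) \<bullet> w1 - c)) *\<^sub>R w1 + (2 * ((x - b2) \<bullet> w2 - c)) *\<^sub>R w2 - (2 * \<delta>) *\<^sub>R x)
      has_derivative (\<lambda>h. (2 * (h \<bullet> w1)) *\<^sub>R w1 + (2 * (h \<bullet> w2)) *\<^sub>R w2 - (2 * \<delta>) *\<^sub>R h)) (at y)"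
proof -
  have l: "((\<lambda>x. (x - b) \<bullet> w - c) has_derivative (\<lambda>h. h \<bullet> w)) (at y)" for b w
    by (auto intro!: derivative_eq_intros)
  have sq: "((\<lambda>x. ((x - b) \<bullet> w - c)\<^sup>2) has_derivative (\<lambda>h. ((2 * ((y - b) \<bullet> w - c)) *\<^sub>R w) \<bullet> h)) (at y)" for b w
    by (rule has_derivative_eq_rhs[OF has_derivative_power[OF l]]) (simp add: fun_eq_iff inner_commute)
  have n: "((\<lambda>x. \<delta> * (x \<bullet> x)) has_derivative (\<lambda>h. ((2 * \<delta>) *\<^sub>R y) \<bullet> h)) (at y)"
    by (rule has_derivative_eq_rhs[OF has_derivative_mult_right[OF
          has_derivative_inner[OF has_derivative_ident has_derivative_ident]]])
       (simp add: fun_eq_iff inner_commute)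
  show "((\<lambda>x. ((x - b1) \<bullet> w1 - c)\<^sup>2 + ((x - b2) \<bullet> w2 - c)\<^sup>2 - \<delta> * (x \<bullet> x)) has_derivative
      (\<lambda>h. ((2 * ((y - b1) \<bullet> w1 - c)) *\<^sub>R w1 + (2 * ((y - b2) \<bullet> w2 - c)) *\<^sub>R w2 - (2 * \<delta>) *\<^sub>R y) \<bullet> h)) (at y)"
    using has_derivative_diff[OF has_derivative_add[OF sq[of b1 w1] sq[of b2 w2]] n]
    by (simp only: inner_add_left inner_diff_left)
  show "((\<lambda>x. (2 * ((x - b1) \<bullet> w1 - c)) *\<^sub>R w1 + (2 * ((x - b2) \<bullet> w2 - c)) *\<^sub>R w2 - (2 * \<delta>) *\<^sub>R x)
      has_derivative (\<lambda>h. (2 * (h \<bullet> w1)) *\<^sub>R w1 + (2 * (h \<bullet> w2)) *\<^sub>R w2 - (2 * \<delta>) *\<^sub>R h)) (at y)"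
    by (intro has_derivative_diff has_derivative_add has_derivative_scaleR_left has_derivative_scaleR_right
        has_derivative_mult_right l has_derivative_ident)
qed

theorem theorem1:
  shows "\<not> (\<exists>(M :: 'm topology) (\<A> :: ('m, 'n::finite) chart set) (F :: 'm \<Rightarrow> (real^'n) \<times> real)
              (b1 :: (real^'n) \<times> real) w1 b2 w2.
           topspace M \<noteq> {} \<and>
           properly_immersed_hypersurface M \<A> F \<and>
           self_translating \<A> F \<and>
           norm w1 = 1 \<and> norm w2 = 1 \<and>
           w1 \<bullet> e_last = 0 \<and> w2 \<bullet> e_last = 0 \<and>
           w1 \<noteq> w2 \<and> w1 \<noteq> - w2 \<and>
           F ` topspace M \<subseteq> halfspace b1 w1 \<inter> halfspace b2 w2)"
proof (rule notI, elim exE conjE)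
  fix M :: "'m topology" and \<A> :: "('m, 'n) chart set" and F :: "'m \<Rightarrow> (real^'n) \<times> real"
    and b1 w1 b2 w2 :: "(real^'n) \<times> real"
  assume ne: "topspace M \<noteq> {}" and pi: "properly_immersed_hypersurface M \<A> F"
    and st: "self_translating \<A> F" and n1: "norm w1 = 1" and n2: "norm w2 = 1"
    and e1: "w1 \<bullet> e_last = 0" and e2: "w2 \<bullet> e_last = 0"
    and ne1: "w1 \<noteq> w2" and ne2: "w1 \<noteq> - w2"
    and wedge: "F ` topspace M \<subseteq> halfspace b1 w1 \<inter> halfspace b2 w2"
  have man: "smooth_manifold M \<A>" and im: "smooth_immersion \<A> F" and proper: "proper_map M euclidean F"
    using pi by (auto simp: properly_immersed_hypersurface_def)
  have cl: "closed (F ` topspace M)"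
    using proper_imp_closed_map[OF proper] unfolding closed_map_def
    by (metis closed_closedin closedin_topspace)
  have neF: "F ` topspace M \<noteq> {}" using ne by blast
  have \<eta>: "1 - \<bar>w1 \<bullet> w2\<bar> > 0" using abs_inner_lt_1[OF n1 n2 ne1 ne2] by simp
  obtain c \<delta> y0 V where y0: "y0 \<in> F ` topspace M" and \<delta>: "\<delta> \<ge> 0"
    "\<delta> * (real CARD('n) + norm y0) < 1 - \<bar>w1 \<bullet> w2\<bar>" and V: "open V" "y0 \<in> V"
    and max: "\<And>x. x \<in> F ` topspace M \<Longrightarrow> x \<in> V \<Longrightarrow>
       ((x - b1) \<bullet> w1 - c)\<^sup>2 + ((x - b2) \<bullet> w2 - c)\<^sup>2 - \<delta> * (x \<bullet> x)
       \<le> ((y0 - b1) \<bullet> w1 - c)\<^sup>2 + ((y0 - b2) \<bullet> w2 - c)\<^sup>2 - \<delta> * (y0 \<bullet> y0)"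
  proof (rule closed_set_in_wedge_touching_quadratic[OF cl neF wedge \<eta> of_nat_0_le_iff[of "CARD('n)"]],
      goal_cases)
    case (1 c \<delta> y U)
    show ?case by (rule 1(1)[OF 1(2-7)])
  qed
  define g where "g x = ((x - b1) \<bullet> w1 - c)\<^sup>2 + ((x - b2) \<bullet> w2 - c)\<^sup>2 - \<delta> * (x \<bullet> x)" for x
  define grad where "grad x = (2 * ((x - b1) \<bullet> w1 - c)) *\<^sub>R w1 + (2 * ((x - b2) \<bullet> w2 - c)) *\<^sub>R w2
      - (2 * \<delta>) *\<^sub>R x" for x
  define Hs where "Hs h = (2 * (h \<bullet> w1)) *\<^sub>R w1 + (2 * (h \<bullet> w2)) *\<^sub>R w2 - (2 * \<delta>) *\<^sub>R h" for h
  have g: "(g has_derivative (\<lambda>h. grad x \<bullet> h)) (at x)" for x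
    unfolding g_def grad_def by (rule wedge_quadratic_derivatives(1))
  have gr: "(grad has_derivative Hs) (at x)" for x
    unfolding grad_def Hs_def by (rule wedge_quadratic_derivatives(2))
  obtain p where p: "p \<in> topspace M" "F p = y0" using y0 by blast
  obtain U \<phi> where ch: "(U, \<phi>) \<in> \<A>" "p \<in> U"
  proof -
    have "p \<in> (\<Union>(U, \<phi>)\<in>\<A>. U)"
      using man p(1) unfolding smooth_manifold_def by blast
    then show thesis using that by blast
  qed
  have "is_chart M (U, \<phi>)" using man ch(1) by (auto simp: smooth_manifold_def)
  then have UM: "U \<subseteq> topspace M" and op: "open (\<phi> ` U)"
    and hom: "homeomorphic_map (subtopology M U) (top_of_set (\<phi> ` U)) \<phi>"
    by (simp_all add: is_chart_def openin_subset)
  have inj: "inj_on \<phi> U"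
    using homeomorphic_imp_injective_map[OF hom] UM by (simp add: topspace_subtopology Int_absorb1)
  define f where "f = chart_repr (U, \<phi>) F"
  define x where "x = \<phi> p"
  have xin: "x \<in> \<phi> ` U" using ch(2) by (simp add: x_def)
  then have xin': "x \<in> snd (U, \<phi>) ` fst (U, \<phi>)" by simp
  have fx: "f x = y0" using ch(2) inj p(2) by (simp add: f_def x_def chart_repr_def)
  have fM: "f u \<in> F ` topspace M" if "u \<in> \<phi> ` U" for u
    using inv_into_into[OF that] UM by (auto simp: f_def chart_repr_def)
  have sm: "smooth_on (\<phi> ` U) f" and imm: "inj (frechet_derivative f (at x))"
    using im ch(1) xin by (auto simp: smooth_immersion_def f_def)
  have trans: "mean_curvature_vector f x = (e_last \<bullet> \<nu>) *\<^sub>R \<nu>" if "unit_normal (tangent_space f x) \<nu>" for \<nu>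
    using st ch(1) xin' that unfolding self_translating_def f_def by blast
  have "Ck_on 0 (\<phi> ` U) f" using sm unfolding smooth_on_def by blast
  then have openW: "open (\<phi> ` U \<inter> f -` V)"
    using op V(1) by (intro continuous_open_preimage) auto
  have W: "\<phi> ` U \<inter> f -` V \<subseteq> \<phi> ` U" "x \<in> \<phi> ` U \<inter> f -` V"
    using xin V(2) fx by auto
  have maxW: "g (f u) \<le> g (f x)" if "u \<in> \<phi> ` U \<inter> f -` V" for u
    using max[of "f u"] fM that by (auto simp: g_def fx)
  obtain t :: "'n \<Rightarrow> (real^'n) \<times> real" and \<nu> where \<nu>: "norm \<nu> = 1" and t: "\<And>k. norm (t k) = 1"
    and pars: "\<And>y z. y \<bullet> z = (\<Sum>k\<in>UNIV. (y \<bullet> t k) * (z \<bullet> t k)) + (y \<bullet> \<nu>) * (z \<bullet> \<nu>)"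
    and ineq: "(\<Sum>k\<in>UNIV. Hs (t k) \<bullet> t k) + grad (f x) \<bullet> e_last \<le> 0"
  proof (rule translator_max_principle[OF op sm openW W imm, where g = g and grad = grad and Hs = Hs])
    fix t :: "'n \<Rightarrow> (real^'n) \<times> real" and \<nu>
    assume "norm \<nu> = 1" "\<And>k. norm (t k) = 1"
      "\<And>y z. y \<bullet> z = (\<Sum>k\<in>UNIV. (y \<bullet> t k) * (z \<bullet> t k)) + (y \<bullet> \<nu>) * (z \<bullet> \<nu>)"
      "(\<Sum>k\<in>UNIV. Hs (t k) \<bullet> t k) + grad (f x) \<bullet> e_last \<le> 0"
    then show thesis by (rule that)
  qed (rule g gr | (rule trans maxW, assumption))+
  \<comment> \<open>By Parseval, the tangential trace is the full trace minus the value on the normal.\<close>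
  have "(\<Sum>k\<in>UNIV. Hs (t k) \<bullet> t k) = (\<Sum>k\<in>UNIV. 2 * ((w1 \<bullet> t k) * (w1 \<bullet> t k)) + 2 * ((w2 \<bullet> t k) * (w2 \<bullet> t k)) - 2 * \<delta>)"
    using t by (intro sum.cong refl)
      (simp add: Hs_def inner_diff_left inner_add_left inner_commute[of _ w1] inner_commute[of _ w2] norm_eq_1)
  also have "\<dots> = 2 * (\<Sum>k\<in>UNIV. (w1 \<bullet> t k) * (w1 \<bullet> t k)) + 2 * (\<Sum>k\<in>UNIV. (w2 \<bullet> t k) * (w2 \<bullet> t k))
      - 2 * \<delta> * real CARD('n)"
    by (simp add: sum.distrib sum_subtractf sum_distrib_left)
  also have "\<dots> = 2 * (2 - ((w1 \<bullet> \<nu>)\<^sup>2 + (w2 \<bullet> \<nu>)\<^sup>2)) - 2 * \<delta> * real CARD('n)"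
    using pars[of w1 w1] pars[of w2 w2] n1 n2 by (simp add: norm_eq_1 power2_eq_square)
  finally have tr: "(\<Sum>k\<in>UNIV. Hs (t k) \<bullet> t k) \<ge> 2 * (1 - \<bar>w1 \<bullet> w2\<bar>) - 2 * \<delta> * real CARD('n)"
    using sum_inner_squares_le[OF n1 n2 \<nu>] by simp
  have "grad (f x) \<bullet> e_last = - 2 * \<delta> * (y0 \<bullet> e_last)"
    using e1 e2 by (simp add: grad_def fx inner_diff_left inner_add_left)
  moreover have "\<delta> * (y0 \<bullet> e_last) \<le> \<delta> * norm y0"
    using norm_cauchy_schwarz[of y0 e_last] \<delta>(1) by (intro mult_left_mono) (auto simp: e_last_def)
  ultimately have "2 * (1 - \<bar>w1 \<bullet> w2\<bar>) \<le> 2 * (\<delta> * (real CARD('n) + norm y0))"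
    using ineq tr by (simp add: algebra_simps)
  then show False using \<delta>(2) by simp
qed

end
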